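(* Let $Q$ be a connected finite acyclic quiver with vertices $1,\dots,n$ labelled as in the context, and let $b_\ast\in\mathbb{C}^n$ be any generic specialization. Let $t_0\ge 0$ be an integer such that $\mu_\ast^t(b_\ast)\in\widetilde X(Q,b_\ast)$ for all $t\ge t_0$. Then $\widetilde X(Q,b_\ast)=X(Q,\mu_\ast^{t_0}(b_\ast))$, and the irreducible components of this variety can be numbered $X_1,\dots,X_m$ with the following properties. (1) For each $t\ge t_0$, $\mu_\ast^t(b_\ast)\in X_i$ if and only if $t\equiv i$ modulo $m$. In particular, for each $t\ge t_0$, $\mu_\ast^t(b_\ast)$ lies in exactly one $X_i$. (2) $X_i$ is the Zariski closure of the set of all $\mu_\ast^{i+km}(b_\ast)$ for all integers $k\ge t_0/m$. (3) For any $a_\ast\in X_i\cap(\mathbb{C}^\times)^n$ we have $\mu_\ast(a_\ast)\in X_{i+1}$ (or $\mu_\ast(a_\ast)\in X_1$ if $i=m$).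
   Context: $Q$ is a connected finite quiver without oriented cycles (multiple arrows allowed), with vertices labelled $1,\dots,n$ so that if there is an arrow $i\to j$ then $i>j$. Coxeter mutation: for $a_\ast=(a_1,\dots,a_n)\in(\mathbb{C}^\times)^n$ put $\mu_\ast(a_\ast)=(a_1',\dots,a_n')\in\mathbb{C}^n$, where recursively for $k=1,\dots,n$ $$a_k'=\frac{1+\prod_{j\to k}a_j\prod_{k\to j}a_j'}{a_k},$$ the products running over all arrows of $Q$ ending at $k$, respectively starting at $k$, counted with multiplicity. (This is the specialization at $x_i=a_i$ of the cluster obtained from the initial cluster $\mathbf{x}=(x_1,\dots,x_n)$ of the cluster algebra of $Q$ by the mutation sequence $\mu_n\circ\cdots\circ\mu_2\circ\mu_1$.) $\mu_\ast^t$ denotes the $t$-fold iterate. A point $a_\ast\in\mathbb{C}^n$ is a generic specialization (of $\mathbf{x}$) if all coordinates of $\mu_\ast^t(a_\ast)$ are nonzero for all $t\ge 0$. The $\mu_\ast$-orbit of $a_\ast$ is $\{\mu_\ast^t(a_\ast):t\ge 0\}$. For a generic specialization $a_\ast$, the generalized frieze variety $X(Q,a_\ast)$ is the Zariski closure in $\mathbb{C}^n$ of the $\mu_\ast$-orbit of $a_\ast$, and $\widetilde X(Q,a_\ast)$ is $X(Q,a_\ast)$ with its zero-dimensional irreducible components removed (so it is empty when $X(Q,a_\ast)$ is finite). *)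

theory Defs
  imports
    "HOL-Analysis.Abstract_Topology"
    "HOL-Library.Extended_Nat"
    "HOL-Library.FuncSet"
    "Graph_Theory.Digraph_Component"
begin

section \<open>Affine space with the Zariski topology\<close>

text \<open>Points of affine space with coordinates indexed by \<open>I\<close> are the functions
  that are \<open>undefined\<close> outside \<open>I\<close>, so equality of points is equality of coordinates.\<close>

definition affine_space :: "nat set \<Rightarrow> (nat \<Rightarrow> complex) set" where
  "affine_space I = I \<rightarrow>\<^sub>E UNIV"

inductive_set polynomial_funs :: "nat set \<Rightarrow> ((nat \<Rightarrow> complex) \<Rightarrow> complex) set"
  for I :: "nat set" where
  const: "(\<lambda>_. c) \<in> polynomial_funs I"
| coord: "i \<in> I \<Longrightarrow> (\<lambda>x. x i) \<in> polynomial_funs I"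
| add: "\<lbrakk>f \<in> polynomial_funs I; g \<in> polynomial_funs I\<rbrakk> \<Longrightarrow> (\<lambda>x. f x + g x) \<in> polynomial_funs I"
| mult: "\<lbrakk>f \<in> polynomial_funs I; g \<in> polynomial_funs I\<rbrakk> \<Longrightarrow> (\<lambda>x. f x * g x) \<in> polynomial_funs I"

definition zero_locus ::
  "nat set \<Rightarrow> ((nat \<Rightarrow> complex) \<Rightarrow> complex) set \<Rightarrow> (nat \<Rightarrow> complex) set" where
  "zero_locus I F = {x \<in> affine_space I. \<forall>f\<in>F. f x = 0}"

definition zariski :: "nat set \<Rightarrow> (nat \<Rightarrow> complex) topology" where
  "zariski I = topology (\<lambda>U. \<exists>F\<subseteq>polynomial_funs I. U = affine_space I - zero_locus I F)"

lemma istopology_zariski: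
  "istopology (\<lambda>U. \<exists>F\<subseteq>polynomial_funs I. U = affine_space I - zero_locus I F)"
  unfolding istopology_def
proof (intro conjI allI impI)
  fix S T
  assume "\<exists>F\<subseteq>polynomial_funs I. S = affine_space I - zero_locus I F"
    and "\<exists>F\<subseteq>polynomial_funs I. T = affine_space I - zero_locus I F"
  then obtain F G where FG: "F \<subseteq> polynomial_funs I" "G \<subseteq> polynomial_funs I"
    and S: "S = affine_space I - zero_locus I F" and T: "T = affine_space I - zero_locus I G"
    by blast
  let ?H = "(\<lambda>(f, g) x. f x * g x) ` (F \<times> G)"
  have "?H \<subseteq> polynomial_funs I"
    using FG by (auto intro: polynomial_funs.mult)
  moreover have "S \<inter> T = affine_space I - zero_locus I ?H"
    unfolding S T zero_locus_def by fastforce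
  ultimately show "\<exists>F\<subseteq>polynomial_funs I. S \<inter> T = affine_space I - zero_locus I F"
    by blast
next
  fix \<U>
  assume "\<forall>U\<in>\<U>. \<exists>F\<subseteq>polynomial_funs I. U = affine_space I - zero_locus I F"
  then obtain F where F: "\<And>U. U \<in> \<U> \<Longrightarrow> F U \<subseteq> polynomial_funs I"
    "\<And>U. U \<in> \<U> \<Longrightarrow> U = affine_space I - zero_locus I (F U)"
    by metis
  have "\<Union>\<U> = affine_space I - zero_locus I (\<Union>U\<in>\<U>. F U)"
    using F(2) unfolding zero_locus_def by (auto; blast)
  moreover have "(\<Union>U\<in>\<U>. F U) \<subseteq> polynomial_funs I"
    using F(1) by blast
  ultimately show "\<exists>F\<subseteq>polynomial_funs I. \<Union>\<U> = affine_space I - zero_locus I F"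
    by blast
qed

lemma openin_zariski:
  "openin (zariski I) U \<longleftrightarrow> (\<exists>F\<subseteq>polynomial_funs I. U = affine_space I - zero_locus I F)"
  unfolding zariski_def topology_inverse'[OF istopology_zariski] ..

lemma topspace_zariski [simp]: "topspace (zariski I) = affine_space I"
proof -
  have "zero_locus I {\<lambda>_. 1} = {}"
    by (simp add: zero_locus_def)
  then have "openin (zariski I) (affine_space I)"
    unfolding openin_zariski
    by (intro exI[of _ "{\<lambda>_. 1}"]) (auto intro: polynomial_funs.const)
  moreover have "U \<subseteq> affine_space I" if "openin (zariski I) U" for U
    using that by (auto simp: openin_zariski)
  ultimately show ?thesis
    by (meson openin_subset openin_topspace subset_antisym)
qed

lemma closedin_zariski:
  "closedin (zariski I) Z \<longleftrightarrow> (\<exists>F\<subseteq>polynomial_funs I. Z = zero_locus I F)"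
proof
  assume "closedin (zariski I) Z"
  then obtain F where "F \<subseteq> polynomial_funs I" "Z \<subseteq> affine_space I"
    "affine_space I - Z = affine_space I - zero_locus I F"
    by (auto simp: closedin_def openin_zariski)
  moreover have "zero_locus I F \<subseteq> affine_space I"
    by (auto simp: zero_locus_def)
  ultimately show "\<exists>F\<subseteq>polynomial_funs I. Z = zero_locus I F"
    by blast
qed (auto simp: closedin_def openin_zariski zero_locus_def)

section \<open>Irreducible components and dimension\<close>

definition irreducible_in :: "'a topology \<Rightarrow> 'a set \<Rightarrow> bool" where
  "irreducible_in T S \<longleftrightarrow> S \<noteq> {} \<and> S \<subseteq> topspace T \<and>
     (\<forall>A B. closedin T A \<and> closedin T B \<and> S \<subseteq> A \<union> B \<longrightarrow> S \<subseteq> A \<or> S \<subseteq> B)"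

definition irreducible_components :: "'a topology \<Rightarrow> 'a set \<Rightarrow> 'a set set" where
  "irreducible_components T S =
     {C. C \<subseteq> S \<and> irreducible_in T C \<and> (\<forall>D. D \<subseteq> S \<and> irreducible_in T D \<and> C \<subseteq> D \<longrightarrow> D = C)}"

text \<open>Krull dimension of the subspace \<open>S\<close>: the supremum of the lengths \<open>l\<close> of chains
  \<open>Z\<^sub>0 \<subset> \<dots> \<subset> Z\<^sub>l\<close> of irreducible closed subsets. It is only meaningful for nonempty \<open>S\<close>
  (it is 0 for the empty set).\<close>

definition krull_dim :: "'a topology \<Rightarrow> 'a set \<Rightarrow> enat" where
  "krull_dim T S = Sup {enat l | l. \<exists>Z :: nat \<Rightarrow> 'a set.
     (\<forall>i\<le>l. closedin (subtopology T S) (Z i) \<and> irreducible_in T (Z i)) \<and>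
     (\<forall>i<l. Z i \<subset> Z (Suc i))}"

section \<open>Coxeter mutation\<close>

type_synonym 'e quiver = "(nat, 'e) pre_digraph"

text \<open>The guard \<open>head Q e < k\<close> makes the recursion terminate for arbitrary \<open>Q\<close>; it is vacuous
  when every arrow goes from a larger to a smaller vertex, see \<open>mutation_coord_rec\<close>.\<close>

function mutation_coord :: "'e quiver \<Rightarrow> (nat \<Rightarrow> complex) \<Rightarrow> nat \<Rightarrow> complex" where
  "mutation_coord Q a k =
     (1 + (\<Prod>e \<in> {e \<in> arcs Q. head Q e = k}. a (tail Q e)) *
          (\<Prod>e \<in> {e \<in> arcs Q. tail Q e = k \<and> head Q e < k}. mutation_coord Q a (head Q e)))
     / a k"
  by pat_completeness auto
termination
  by (relation "measure (\<lambda>(Q, a, k). k)") auto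

declare mutation_coord.simps [simp del]

lemma mutation_coord_rec:
  assumes "\<And>e. e \<in> arcs Q \<Longrightarrow> head Q e < tail Q e"
  shows "mutation_coord Q a k =
     (1 + (\<Prod>e \<in> {e \<in> arcs Q. head Q e = k}. a (tail Q e)) *
          (\<Prod>e \<in> {e \<in> arcs Q. tail Q e = k}. mutation_coord Q a (head Q e)))
     / a k"
proof -
  have "{e \<in> arcs Q. tail Q e = k \<and> head Q e < k} = {e \<in> arcs Q. tail Q e = k}"
    using assms by auto
  then show ?thesis
    using mutation_coord.simps[of Q a k] by simp
qed

definition coxeter_mutation :: "'e quiver \<Rightarrow> (nat \<Rightarrow> complex) \<Rightarrow> (nat \<Rightarrow> complex)" where
  "coxeter_mutation Q a = restrict (mutation_coord Q a) (verts Q)"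

text \<open>Division by zero is total in HOL, so iterates are always defined; but they are the
  intended ones as long as no coordinate of an earlier iterate vanishes, and
  \<open>generic_specialization\<close> fails at the first vanishing coordinate.\<close>

definition generic_specialization :: "'e quiver \<Rightarrow> (nat \<Rightarrow> complex) \<Rightarrow> bool" where
  "generic_specialization Q a \<longleftrightarrow> a \<in> affine_space (verts Q) \<and>
     (\<forall>t. \<forall>k\<in>verts Q. (coxeter_mutation Q ^^ t) a k \<noteq> 0)"

definition mutation_orbit :: "'e quiver \<Rightarrow> (nat \<Rightarrow> complex) \<Rightarrow> (nat \<Rightarrow> complex) set" where
  "mutation_orbit Q a = {(coxeter_mutation Q ^^ t) a | t. True}"

definition frieze_variety :: "'e quiver \<Rightarrow> (nat \<Rightarrow> complex) \<Rightarrow> (nat \<Rightarrow> complex) set" where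
  "frieze_variety Q a = zariski (verts Q) closure_of mutation_orbit Q a"

definition reduced_frieze_variety :: "'e quiver \<Rightarrow> (nat \<Rightarrow> complex) \<Rightarrow> (nat \<Rightarrow> complex) set" where
  "reduced_frieze_variety Q a =
     \<Union>{C \<in> irreducible_components (zariski (verts Q)) (frieze_variety Q a).
          krull_dim (zariski (verts Q)) C \<noteq> 0}"

end

theory Submission
  imports Defs "HOL-Library.Function_Algebras"
begin

text \<open>
  The proof is topological. Write \<open>x t\<close> for the \<open>t\<close>-th iterate of \<open>b\<close> under Coxeter mutation \<open>\<mu>\<close>.
  The Zariski topology is Noetherian by Hilbert's basis theorem (\<open>noetherian_zariski\<close>), so all closed
  sets have finitely many irreducible components. A component of positive dimension of the closure
  of the orbit is not affected when finitely many points are deleted from the orbit. Since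
  \<open>x t\<close> lies in the reduced variety for all \<open>t \<ge> t\<^sub>0\<close>, that variety is therefore the closure of every
  tail \<open>{x t | t \<ge> s}\<close> with \<open>s \<ge> t\<^sub>0\<close> (\<open>closure_tail_eq_positive_dim_components\<close>). This recurrence
  property drives everything else.

  The map \<open>\<mu>\<close> is continuous on the torus (\<open>continuous_coxeter_mutation\<close>), hence maps irreducible sets
  to irreducible sets. So the closure of the image of a component lies in some component. As the
  images together are dense by recurrence, each component is such a closure, and by finiteness
  \<open>\<mu>\<close> permutes the components (\<open>bij_next_component\<close>). The components visited by the orbit already
  contain a tail of the orbit, so the permutation is one cycle of length \<open>m\<close>, and numbering along
  the cycle puts \<open>x t\<close> into \<open>X i\<close> whenever \<open>t \<equiv> i\<close> modulo \<open>m\<close> (\<open>cyclic_numbering\<close>). If some \<open>x t\<close> were on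
  two components, so would be all later points, and the closure of that tail would
  be covered by intersections of different components, which is absurd (\<open>unique_component\<close>).
  Property (2) is the density of every tail of the orbit in each component, and (3) holds because the
  continuous map \<open>\<mu>\<close> sends the part of \<open>X i\<close> in the torus, where the orbit points of \<open>X i\<close> are dense,
  into the closure of their images.
\<close>

section \<open>Hilbert's basis theorem for polynomial functions\<close>

text \<open>Chains of ideals are compared inside subsets of an ambient commutative ring, because the rings of
  polynomial functions in different sets of variables are all sets of functions of the same type.
  Closure under subtraction also yields zero, negatives and sums.\<close>

definition subring :: "'b::comm_ring_1 set \<Rightarrow> bool" where
  "subring R \<longleftrightarrow> 1 \<in> R \<and> (\<forall>a\<in>R. \<forall>b\<in>R. a - b \<in> R \<and> a * b \<in> R)"

definition ideal_in :: "'b::comm_ring_1 set \<Rightarrow> 'b set \<Rightarrow> bool" where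
  "ideal_in R I \<longleftrightarrow>
     I \<subseteq> R \<and> 0 \<in> I \<and> (\<forall>a\<in>I. \<forall>b\<in>I. a - b \<in> I) \<and> (\<forall>r\<in>R. \<forall>a\<in>I. r * a \<in> I)"

text \<open>The ascending chain condition. Its translation through vanishing ideals is the descending
  chain condition for closed sets.\<close>

definition ideals_stabilize :: "'b::comm_ring_1 set \<Rightarrow> bool" where
  "ideals_stabilize R \<longleftrightarrow>
     (\<forall>I. mono I \<and> (\<forall>j::nat. ideal_in R (I j)) \<longrightarrow> (\<exists>N. \<forall>j\<ge>N. I j = I N))"

text \<open>The values at \<open>x\<close> of the polynomials over \<open>R\<close> of degree less than \<open>d\<close>. The element \<open>x\<close> may be
  algebraic over \<open>R\<close>, so a value may come from several polynomials.\<close>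

primrec polys_below :: "'b::comm_ring_1 set \<Rightarrow> 'b \<Rightarrow> nat \<Rightarrow> 'b set" where
  "polys_below R x 0 = {0}"
| "polys_below R x (Suc d) = {h + g * x ^ d | h g. h \<in> polys_below R x d \<and> g \<in> R}"

definition leading_coeffs :: "'b::comm_ring_1 set \<Rightarrow> 'b \<Rightarrow> 'b set \<Rightarrow> nat \<Rightarrow> 'b set" where
  "leading_coeffs R x I d = {g \<in> R. \<exists>h\<in>polys_below R x d. h + g * x ^ d \<in> I}"

lemma ideal_add:
  assumes I: "ideal_in S I" and "f \<in> I" "g \<in> I"
  shows "f + g \<in> I"
proof -
  have "f - (0 - g) \<in> I"
    using assms unfolding ideal_in_def by blast
  then show ?thesis
    by simp
qed

context
  fixes R :: "'b::comm_ring_1 set" and x :: 'b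
  assumes R: "subring R"
begin

lemma subring_zero: "0 \<in> R"
  using R unfolding subring_def by (metis diff_self)

lemma subring_closed:
  assumes "a \<in> R" "b \<in> R"
  shows "a - b \<in> R" "a * b \<in> R" "a + b \<in> R"
proof -
  show "a - b \<in> R" "a * b \<in> R"
    using R assms unfolding subring_def by auto
  have "a - (0 - b) \<in> R"
    using R assms subring_zero unfolding subring_def by blast
  then show "a + b \<in> R"
    by simp
qed

lemma zero_in_polys_below: "0 \<in> polys_below R x d"
proof (induction d)
  case (Suc d)
  have "0 = 0 + 0 * x ^ d"
    by simp
  with Suc subring_zero show ?case
    unfolding polys_below.simps by blast
qed simp

lemma polys_below_Suc: "polys_below R x d \<subseteq> polys_below R x (Suc d)"
proof
  fix f assume "f \<in> polys_below R x d"
  moreover have "f = f + 0 * x ^ d"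
    by simp
  ultimately show "f \<in> polys_below R x (Suc d)"
    using subring_zero unfolding polys_below.simps by blast
qed

lemma polys_below_mono: "d \<le> e \<Longrightarrow> polys_below R x d \<subseteq> polys_below R x e"
  using lift_Suc_mono_le[of "polys_below R x"] polys_below_Suc by blast

lemma polys_below_add:
  "\<lbrakk>f \<in> polys_below R x d; g \<in> polys_below R x d\<rbrakk> \<Longrightarrow> f + g \<in> polys_below R x d"
proof (induction d arbitrary: f g)
  case (Suc d)
  then obtain h r h' r' where "f = h + r * x ^ d" "g = h' + r' * x ^ d"
    and in_R: "r \<in> R" "r' \<in> R" and below: "h \<in> polys_below R x d" "h' \<in> polys_below R x d"
    by auto
  then have "f + g = (h + h') + (r + r') * x ^ d"
    by (simp add: algebra_simps)
  with Suc.IH[OF below] subring_closed(3)[OF in_R] show ?case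
    unfolding polys_below.simps by blast
qed simp

lemma polys_below_scale:
  "\<lbrakk>r \<in> R; f \<in> polys_below R x d\<rbrakk> \<Longrightarrow> r * f \<in> polys_below R x d"
proof (induction d arbitrary: f)
  case (Suc d)
  then obtain h g where f: "f = h + g * x ^ d" and "g \<in> R" "h \<in> polys_below R x d"
    by auto
  with Suc have "r * h \<in> polys_below R x d" "r * g \<in> R"
    by (auto intro: subring_closed)
  moreover have "r * f = r * h + (r * g) * x ^ d"
    by (simp add: f algebra_simps)
  ultimately show ?case
    unfolding polys_below.simps by blast
qed simp

lemma polys_below_diff:
  assumes "f \<in> polys_below R x d" "g \<in> polys_below R x d"
  shows "f - g \<in> polys_below R x d"
proof -
  have "1 \<in> R"
    using R by (simp add: subring_def)
  then have "(0 - 1) * g \<in> polys_below R x d"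
    by (intro polys_below_scale assms subring_closed subring_zero)
  from polys_below_add[OF assms(1) this] show ?thesis
    by simp
qed

lemma polys_below_shift:
  "f \<in> polys_below R x d \<Longrightarrow> x * f \<in> polys_below R x (Suc d)"
proof (induction d arbitrary: f)
  case 0
  then show ?case
    using zero_in_polys_below[of "Suc 0"] by simp
next
  case (Suc d)
  then obtain h g where f: "f = h + g * x ^ d" and "g \<in> R" "h \<in> polys_below R x d"
    by auto
  moreover have "x * f = x * h + g * x ^ Suc d"
    by (simp add: f algebra_simps)
  ultimately show ?case
    using Suc.IH[of h] polys_below.simps(2)[of R x "Suc d"] by blast
qed

lemma polys_below_mult:
  "\<lbrakk>f \<in> polys_below R x d; g \<in> polys_below R x e\<rbrakk> \<Longrightarrow> f * g \<in> polys_below R x (d + e)"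
proof (induction d arbitrary: f)
  case 0
  then show ?case
    using zero_in_polys_below by simp
next
  case (Suc d)
  then obtain h r where f: "f = h + r * x ^ d" and "r \<in> R" "h \<in> polys_below R x d"
    by auto
  have "x ^ i * g \<in> polys_below R x (i + e)" for i
  proof (induction i)
    case (Suc i)
    then show ?case
      using polys_below_shift[of "x ^ i * g" "i + e"] by (simp add: mult.assoc del: polys_below.simps)
  qed (use Suc.prems in simp)
  then have "r * (x ^ d * g) \<in> polys_below R x (d + e)"
    using \<open>r \<in> R\<close> polys_below_scale by blast
  then have "h * g + r * (x ^ d * g) \<in> polys_below R x (d + e)"
    using Suc.IH Suc.prems(2) \<open>h \<in> polys_below R x d\<close> polys_below_add by blast
  then show ?case
    using polys_below_Suc[of "d + e"] by (auto simp: f algebra_simps simp del: polys_below.simps)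
qed

lemma leading_coeffs_ideal:
  assumes I: "ideal_in S I" and "R \<subseteq> S"
  shows "ideal_in R (leading_coeffs R x I d)"
  unfolding ideal_in_def
proof (intro conjI ballI)
  show "leading_coeffs R x I d \<subseteq> R"
    by (auto simp: leading_coeffs_def)
  have "0 + 0 * x ^ d \<in> I"
    using I by (simp add: ideal_in_def)
  then show "0 \<in> leading_coeffs R x I d"
    unfolding leading_coeffs_def using subring_zero zero_in_polys_below by blast
next
  fix a b assume "a \<in> leading_coeffs R x I d" "b \<in> leading_coeffs R x I d"
  then obtain h k where ab: "a \<in> R" "b \<in> R" and below: "h \<in> polys_below R x d" "k \<in> polys_below R x d"
    and "h + a * x ^ d \<in> I" "k + b * x ^ d \<in> I"
    by (auto simp: leading_coeffs_def)
  then have "(h + a * x ^ d) - (k + b * x ^ d) \<in> I"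
    using I unfolding ideal_in_def by blast
  then have "(h - k) + (a - b) * x ^ d \<in> I"
    by (simp add: algebra_simps)
  then show "a - b \<in> leading_coeffs R x I d"
    unfolding leading_coeffs_def using subring_closed(1)[OF ab] polys_below_diff[OF below] by blast
next
  fix r a assume r: "r \<in> R" and "a \<in> leading_coeffs R x I d"
  then obtain h where a: "a \<in> R" and h: "h \<in> polys_below R x d" and "h + a * x ^ d \<in> I"
    by (auto simp: leading_coeffs_def)
  then have "r * (h + a * x ^ d) \<in> I"
    using I r \<open>R \<subseteq> S\<close> unfolding ideal_in_def by blast
  then have "r * h + (r * a) * x ^ d \<in> I"
    by (simp add: algebra_simps)
  then show "r * a \<in> leading_coeffs R x I d"
    unfolding leading_coeffs_def using subring_closed(2)[OF r a] polys_below_scale[OF r h] by blast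
qed

text \<open>Multiplication by \<open>x\<close> raises the degree and keeps the leading coefficient.\<close>

lemma leading_coeffs_mono_degree:
  assumes I: "ideal_in S I" and "x \<in> S" and "d \<le> e"
  shows "leading_coeffs R x I d \<subseteq> leading_coeffs R x I e"
proof -
  have "leading_coeffs R x I d \<subseteq> leading_coeffs R x I (Suc d)" for d
  proof
    fix g assume "g \<in> leading_coeffs R x I d"
    then obtain h where g: "g \<in> R" and h: "h \<in> polys_below R x d" and "h + g * x ^ d \<in> I"
      by (auto simp: leading_coeffs_def)
    then have "x * (h + g * x ^ d) \<in> I"
      using I \<open>x \<in> S\<close> unfolding ideal_in_def by blast
    then have "x * h + g * x ^ Suc d \<in> I"
      by (simp add: algebra_simps)
    then show "g \<in> leading_coeffs R x I (Suc d)"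
      unfolding leading_coeffs_def using g polys_below_shift[OF h] by blast
  qed
  then show ?thesis
    using lift_Suc_mono_le[of "leading_coeffs R x I"] \<open>d \<le> e\<close> by blast
qed

text \<open>Hilbert's argument. The ideals \<open>L j d\<close> of leading coefficients of the elements of \<open>I j\<close> of degree
  \<open>d\<close> increase in both arguments. The diagonal chain settles all large \<open>d\<close> at once, and for each of
  the remaining finitely many \<open>d\<close> the chain in \<open>j\<close> becomes stable, so from some \<open>N\<close> on nothing
  changes. An element of a later ideal can then be reduced to \<open>0\<close> by successively subtracting
  elements of \<open>I N\<close> with the same leading coefficient.\<close>

theorem hilbert_basis:
  assumes noeth: "ideals_stabilize R" and "R \<subseteq> S" "x \<in> S"
    and poly: "S \<subseteq> (\<Union>d. polys_below R x d)"
  shows "ideals_stabilize S"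
  unfolding ideals_stabilize_def
proof (intro allI impI)
  fix I :: "nat \<Rightarrow> 'b set"
  assume "mono I \<and> (\<forall>j. ideal_in S (I j))"
  then have mono: "\<And>i j. i \<le> j \<Longrightarrow> I i \<subseteq> I j" and ideal: "\<And>j. ideal_in S (I j)"
    by (auto simp: mono_def)
  define L where "L j d = leading_coeffs R x (I j) d" for j d
  have L_mono: "L i d \<subseteq> L j e" if "i \<le> j" "d \<le> e" for i j d e
  proof -
    have "L i d \<subseteq> L j d"
      using mono[OF \<open>i \<le> j\<close>] by (auto simp: L_def leading_coeffs_def)
    also have "\<dots> \<subseteq> L j e"
      unfolding L_def using leading_coeffs_mono_degree[OF ideal \<open>x \<in> S\<close> \<open>d \<le> e\<close>] .
    finally show ?thesis .
  qed
  have L_ideal: "ideal_in R (L j d)" for j d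
    unfolding L_def using leading_coeffs_ideal[OF ideal \<open>R \<subseteq> S\<close>] .
  have stable: "\<exists>N. \<forall>j\<ge>N. J j = J N" if "mono J" "\<And>j. ideal_in R (J j)" for J :: "nat \<Rightarrow> 'b set"
    using noeth that unfolding ideals_stabilize_def by blast
  \<comment> \<open>the diagonal bounds all degrees from \<open>D\<close> on\<close>
  have "\<exists>N. \<forall>j\<ge>N. L j j = L N N"
    by (rule stable) (simp_all add: monoI L_mono L_ideal)
  then obtain D where D: "\<And>j. j \<ge> D \<Longrightarrow> L j j = L D D"
    by blast
  have "\<exists>N. \<forall>j\<ge>N. L j d = L N d" for d
    by (rule stable) (simp_all add: monoI L_mono L_ideal)
  then obtain M where M: "\<And>d j. j \<ge> M d \<Longrightarrow> L j d = L (M d) d"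
    by metis
  define N where "N = Max (insert D (M ` {..<D}))"
  have "D \<le> N" and M_le: "\<And>d. d < D \<Longrightarrow> M d \<le> N"
    by (auto simp: N_def)
  have L_stable: "L j d \<subseteq> L N d" if "j \<ge> N" for j d
  proof (cases "d < D")
    case True
    then show ?thesis
      using M[of d j] M[of d N] M_le[of d] that by simp
  next
    case False
    have "L j d \<subseteq> L (max j d) (max j d)"
      by (rule L_mono) auto
    also have "\<dots> = L D D"
      using False by (intro D) auto
    also have "\<dots> \<subseteq> L N d"
      using False \<open>D \<le> N\<close> by (intro L_mono) auto
    finally show ?thesis .
  qed
  have reduce: "f \<in> I N" if "j \<ge> N" "f \<in> polys_below R x d" "f \<in> I j" for f j d
    using that(2,3)
  proof (induction d arbitrary: f)
    case 0
    then show ?case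
      using ideal[of N] by (simp add: ideal_in_def)
  next
    case (Suc d)
    then obtain h g where f: "f = h + g * x ^ d" and g: "g \<in> R" and h: "h \<in> polys_below R x d"
      by auto
    with Suc.prems have "g \<in> L j d"
      by (auto simp: L_def leading_coeffs_def)
    with L_stable[OF \<open>j \<ge> N\<close>] obtain k where k: "k \<in> polys_below R x d" and kI: "k + g * x ^ d \<in> I N"
      by (auto simp: L_def leading_coeffs_def)
    have "f - (k + g * x ^ d) \<in> I j"
      using ideal[of j] Suc.prems(2) kI mono[OF \<open>j \<ge> N\<close>] unfolding ideal_in_def by blast
    moreover have "f - (k + g * x ^ d) = h - k"
      by (simp add: f)
    ultimately have "h - k \<in> I N"
      using Suc.IH polys_below_diff[OF h k] by simp
    then have "(h - k) + (k + g * x ^ d) \<in> I N"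
      using ideal_add[OF ideal] kI by blast
    then show ?case
      by (simp add: f)
  qed
  have "I j \<subseteq> I N" if "j \<ge> N" for j
  proof
    fix f assume "f \<in> I j"
    then obtain d where "f \<in> polys_below R x d"
      using ideal[of j] poly by (auto simp: ideal_in_def)
    with reduce[OF that _ \<open>f \<in> I j\<close>] show "f \<in> I N"
      by blast
  qed
  then have "I j = I N" if "j \<ge> N" for j
    using mono[OF that] that by (simp add: subset_antisym)
  then show "\<exists>N. \<forall>j\<ge>N. I j = I N"
    by blast
qed

end

lemma subring_polynomial_funs: "subring (polynomial_funs I)"
  unfolding subring_def
proof (intro conjI ballI)
  show "1 \<in> polynomial_funs I"
    using polynomial_funs.const[of 1 I] by (simp add: one_fun_def)
  fix f g assume fg: "f \<in> polynomial_funs I" "g \<in> polynomial_funs I"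
  show "f * g \<in> polynomial_funs I"
    using polynomial_funs.mult[OF fg] by (simp add: times_fun_def)
  have "(\<lambda>x. f x + (- 1) * g x) \<in> polynomial_funs I"
    by (intro polynomial_funs.intros fg)
  then show "f - g \<in> polynomial_funs I"
    by (simp add: fun_diff_def)
qed

lemma polynomial_funs_mono: "I \<subseteq> J \<Longrightarrow> polynomial_funs I \<subseteq> polynomial_funs J"
proof
  fix f assume "I \<subseteq> J" "f \<in> polynomial_funs I"
  from this(2) show "f \<in> polynomial_funs J"
    by induction (use \<open>I \<subseteq> J\<close> in \<open>auto intro: polynomial_funs.intros\<close>)
qed

lemma polynomial_funs_insert:
  "polynomial_funs (insert k I) \<subseteq> (\<Union>d. polys_below (polynomial_funs I) (\<lambda>x. x k) d)"
proof
  let ?P = "polys_below (polynomial_funs I) (\<lambda>x. x k)"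
  note R = subring_polynomial_funs[of I]
  have base: "f \<in> ?P 1" if "f \<in> polynomial_funs I" for f
  proof -
    have "f = 0 + f * (\<lambda>x. x k) ^ 0"
      by simp
    with that show ?thesis
      unfolding One_nat_def polys_below.simps by blast
  qed
  fix f assume "f \<in> polynomial_funs (insert k I)"
  then show "f \<in> (\<Union>d. ?P d)"
  proof induction
    case (const c)
    then show ?case
      using base polynomial_funs.const by blast
  next
    case (coord i)
    show ?case
    proof (cases "i \<in> I")
      case True
      then show ?thesis
        using base polynomial_funs.coord by blast
    next
      case False
      with coord have "i = k" by simp
      have "(\<lambda>x. x k) * 1 \<in> ?P (Suc 1)"
        using base polynomial_funs.const[of 1 I] by (intro polys_below_shift[OF R]) (simp add: one_fun_def)
      then show ?thesis
        unfolding \<open>i = k\<close> mult_1_right by blast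
    qed
  next
    case (add f g)
    then obtain d e where "f \<in> ?P d" "g \<in> ?P e"
      by blast
    then have "f \<in> ?P (max d e)" "g \<in> ?P (max d e)"
      using polys_below_mono[OF R] by (meson max.cobounded1 max.cobounded2 subsetD)+
    then have "f + g \<in> ?P (max d e)"
      by (rule polys_below_add[OF R])
    then show ?case
      unfolding plus_fun_def by blast
  next
    case (mult f g)
    then obtain d e where "f \<in> ?P d" "g \<in> ?P e"
      by blast
    then have "f * g \<in> ?P (d + e)"
      by (rule polys_below_mult[OF R])
    then show ?case
      unfolding times_fun_def by blast
  qed
qed

text \<open>Induction on the number of variables; without variables the ring is the field of constants,
  where an ideal with a nonzero element is everything.\<close>

theorem ideals_stabilize_polynomial_funs:
  assumes "finite I"
  shows "ideals_stabilize (polynomial_funs I)"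
  using assms
proof induction
  case empty
  have const_fun: "\<exists>c. f = (\<lambda>_. c)" if "f \<in> polynomial_funs {}" for f
    using that by induction auto
  show ?case
    unfolding ideals_stabilize_def
  proof (intro allI impI)
    fix I :: "nat \<Rightarrow> ((nat \<Rightarrow> complex) \<Rightarrow> complex) set"
    assume "mono I \<and> (\<forall>j. ideal_in (polynomial_funs {}) (I j))"
    then have mono: "\<And>i j. i \<le> j \<Longrightarrow> I i \<subseteq> I j" and ideal: "\<And>j. ideal_in (polynomial_funs {}) (I j)"
      by (auto simp: mono_def)
    show "\<exists>N. \<forall>j\<ge>N. I j = I N"
    proof (cases "\<forall>j. I j \<subseteq> {0}")
      case True
      then have "I j = {0}" for j
        using ideal[of j] unfolding ideal_in_def by blast
      then show ?thesis
        by simp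
    next
      case False
      then obtain N f where f: "f \<in> I N" "f \<noteq> 0"
        by blast
      then obtain c where c: "f = (\<lambda>_. c)"
        using const_fun ideal[of N] unfolding ideal_in_def by blast
      with f have "c \<noteq> 0"
        by (auto simp: zero_fun_def)
      have "polynomial_funs {} \<subseteq> I j" if "j \<ge> N" for j
      proof
        fix g assume g: "g \<in> polynomial_funs {}"
        have "(\<lambda>x. g x * inverse c) * f \<in> I j"
          using ideal[of j] f mono[OF that] polynomial_funs.mult[OF g polynomial_funs.const]
          unfolding ideal_in_def by blast
        then show "g \<in> I j"
          using \<open>c \<noteq> 0\<close> by (simp add: c times_fun_def mult.assoc)
      qed
      then have "I j = polynomial_funs {}" if "j \<ge> N" for j
        using that ideal[of j] unfolding ideal_in_def by blast
      then show ?thesis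
        by (intro exI[of _ N]) auto
    qed
  qed
next
  case (insert k I)
  show ?case
  proof (rule hilbert_basis[OF subring_polynomial_funs insert.IH])
    show "polynomial_funs I \<subseteq> polynomial_funs (insert k I)"
      by (rule polynomial_funs_mono) blast
    show "(\<lambda>x. x k) \<in> polynomial_funs (insert k I)"
      by (rule polynomial_funs.coord) blast
  qed (rule polynomial_funs_insert)
qed

section \<open>Noetherian spaces\<close>

definition noetherian_space :: "'a topology \<Rightarrow> bool" where
  "noetherian_space T \<longleftrightarrow>
     (\<nexists>Z :: nat \<Rightarrow> 'a set. \<forall>i. closedin T (Z i) \<and> Z (Suc i) \<subset> Z i)"

text \<open>A strictly descending chain of closed sets would give an ascending chain of vanishing ideals; a
  closed set is recovered from its vanishing ideal, so the chain of ideals would never stop.\<close>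

lemma noetherian_zariski:
  assumes "finite I"
  shows "noetherian_space (zariski I)"
  unfolding noetherian_space_def
proof
  assume "\<exists>Z. \<forall>i. closedin (zariski I) (Z i) \<and> Z (Suc i) \<subset> Z i"
  then obtain Z :: "nat \<Rightarrow> (nat \<Rightarrow> complex) set"
    where "\<forall>i. closedin (zariski I) (Z i) \<and> Z (Suc i) \<subset> Z i" ..
  then have Z: "\<And>i. closedin (zariski I) (Z i)" "\<And>i. Z (Suc i) \<subset> Z i"
    by simp_all
  define V where "V i = {f \<in> polynomial_funs I. \<forall>x\<in>Z i. f x = 0}" for i
  have "V i \<subseteq> V (Suc i)" for i
    using Z(2)[of i] by (auto simp: V_def)
  then have "mono V"
    by (simp add: mono_iff_le_Suc)
  have "ideal_in (polynomial_funs I) (V i)" for i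
    unfolding ideal_in_def
  proof (intro conjI ballI)
    show "V i \<subseteq> polynomial_funs I"
      by (auto simp: V_def)
    show "0 \<in> V i"
      using subring_zero[OF subring_polynomial_funs] by (simp add: V_def zero_fun_def)
  next
    fix f g assume "f \<in> V i" "g \<in> V i"
    then show "f - g \<in> V i"
      using subring_closed(1)[OF subring_polynomial_funs] by (simp add: V_def)
  next
    fix r f assume "r \<in> polynomial_funs I" "f \<in> V i"
    then show "r * f \<in> V i"
      using subring_closed(2)[OF subring_polynomial_funs] by (simp add: V_def)
  qed
  then have "\<exists>N. \<forall>j\<ge>N. V j = V N"
    using ideals_stabilize_polynomial_funs[OF assms] \<open>mono V\<close>
    unfolding ideals_stabilize_def by blast
  then obtain N where "\<forall>j\<ge>N. V j = V N"
    by blast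
  then have N: "V (Suc N) = V N"
    using le_SucI[OF order_refl] by blast
  have locus: "Z i = zero_locus I (V i)" for i
  proof -
    obtain F where F: "F \<subseteq> polynomial_funs I" "Z i = zero_locus I F"
      using Z(1)[of i] unfolding closedin_zariski by blast
    show ?thesis
    proof
      show "Z i \<subseteq> zero_locus I (V i)"
        using closedin_subset[OF Z(1)[of i]] by (auto simp: V_def zero_locus_def)
      have "F \<subseteq> V i"
        unfolding V_def F(2) using F(1) by (auto simp: zero_locus_def)
      then show "zero_locus I (V i) \<subseteq> Z i"
        unfolding F(2) by (auto simp: zero_locus_def)
    qed
  qed
  show False
    using locus[of N] locus[of "Suc N"] N Z(2)[of N] by simp
qed

lemma irreducible_in_finite_Union:
  assumes "irreducible_in T C" "finite F" "\<And>A. A \<in> F \<Longrightarrow> closedin T A" "C \<subseteq> \<Union>F"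
  obtains A where "A \<in> F" "C \<subseteq> A"
proof -
  have "\<exists>A\<in>F. C \<subseteq> A"
    using assms(2-4)
  proof (induction F rule: finite_induct)
    case empty
    then show ?case
      using assms(1) by (simp add: irreducible_in_def)
  next
    case (insert A F)
    then have "closedin T A" "closedin T (\<Union>F)" "C \<subseteq> A \<union> \<Union>F"
      by (auto intro: closedin_Union)
    then have "C \<subseteq> A \<or> C \<subseteq> \<Union>F"
      using assms(1) unfolding irreducible_in_def by blast
    with insert show ?case
      by auto
  qed
  then show thesis
    using that by blast
qed

text \<open>Noetherian induction: a reducible closed set is the union of two smaller closed sets.\<close>

lemma noetherian_irreducible_decomposition:
  assumes "noetherian_space T" "closedin T S"
  shows "\<exists>F. finite F \<and> (\<forall>A\<in>F. closedin T A \<and> irreducible_in T A) \<and> S = \<Union>F"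
proof -
  let ?r = "{(A, B). closedin T A \<and> closedin T B \<and> A \<subset> B}"
  have "wf ?r"
    unfolding wf_iff_no_infinite_down_chain
  proof
    assume "\<exists>Z. \<forall>i. (Z (Suc i), Z i) \<in> ?r"
    then obtain Z where "\<forall>i. (Z (Suc i), Z i) \<in> ?r" ..
    then have "\<forall>i. closedin T (Z i) \<and> Z (Suc i) \<subset> Z i"
      by simp
    with assms(1) show False
      unfolding noetherian_space_def by (elim notE) (rule exI)
  qed
  then show ?thesis
    using assms(2)
  proof (induction S rule: wf_induct_rule)
    case (less S)
    consider "S = {}" | "irreducible_in T S" |
      A B where "closedin T A" "closedin T B" "S \<subseteq> A \<union> B" "\<not> S \<subseteq> A" "\<not> S \<subseteq> B"
      unfolding irreducible_in_def using closedin_subset[OF less.prems] by blast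
    then show ?case
    proof cases
      case 1
      then show ?thesis
        by (intro exI[of _ "{}"]) auto
    next
      case 2
      then show ?thesis
        using less.prems by (intro exI[of _ "{S}"]) auto
    next
      case 3
      have closed: "closedin T (S \<inter> A)" "closedin T (S \<inter> B)"
        using 3 less.prems by auto
      have "S \<inter> A \<subset> S" "S \<inter> B \<subset> S"
        using 3 by auto
      then have "(S \<inter> A, S) \<in> ?r" "(S \<inter> B, S) \<in> ?r"
        using closed less.prems by auto
      then obtain F G where
        F: "finite F" "\<forall>A\<in>F. closedin T A \<and> irreducible_in T A" "S \<inter> A = \<Union>F" and
        G: "finite G" "\<forall>A\<in>G. closedin T A \<and> irreducible_in T A" "S \<inter> B = \<Union>G"
        using less.IH closed by meson
      have "S = (S \<inter> A) \<union> (S \<inter> B)"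
        using 3 by blast
      also have "\<dots> = \<Union>(F \<union> G)"
        by (simp only: F G Union_Un_distrib)
      finally show ?thesis
        using F(1,2) G(1,2) by (intro exI[of _ "F \<union> G"] conjI finite_UnI) blast+
    qed
  qed
qed

text \<open>The components are the maximal members of any finite decomposition into irreducible closed sets.\<close>

lemma noetherian_components:
  assumes "noetherian_space T" "closedin T S"
  shows finite_irreducible_components: "finite (irreducible_components T S)"
    and closedin_irreducible_component: "C \<in> irreducible_components T S \<Longrightarrow> closedin T C"
    and irreducible_subset_component:
      "\<lbrakk>irreducible_in T D; D \<subseteq> S\<rbrakk> \<Longrightarrow> \<exists>C\<in>irreducible_components T S. D \<subseteq> C"
    and Union_irreducible_components: "\<Union>(irreducible_components T S) = S"
proof -
  obtain F where F: "finite F" "\<And>A. A \<in> F \<Longrightarrow> closedin T A \<and> irreducible_in T A" "S = \<Union>F"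
    using noetherian_irreducible_decomposition[OF assms] by blast
  have below: "\<exists>A\<in>F. D \<subseteq> A" if "irreducible_in T D" "D \<subseteq> S" for D
    using irreducible_in_finite_Union[OF that(1) F(1)] F(2) that(2)[unfolded F(3)] by metis
  have in_F: "C \<in> F" if "C \<in> irreducible_components T S" for C
  proof -
    have C: "irreducible_in T C" "C \<subseteq> S" "\<And>D. \<lbrakk>D \<subseteq> S; irreducible_in T D; C \<subseteq> D\<rbrakk> \<Longrightarrow> D = C"
      using that unfolding irreducible_components_def by auto
    obtain A where A: "A \<in> F" "C \<subseteq> A"
      using below[OF C(1,2)] by blast
    have "A \<subseteq> S"
      unfolding F(3) using A(1) by (rule Union_upper)
    then have "A = C"
      using C(3)[OF _ _ A(2)] F(2)[OF A(1)] by simp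
    with A show ?thesis
      by simp
  qed
  show "finite (irreducible_components T S)"
    using in_F F(1) by (meson finite_subset subsetI)
  show "closedin T C" if "C \<in> irreducible_components T S"
    using in_F[OF that] F(2) by blast
  have above: "\<exists>C\<in>irreducible_components T S. A \<subseteq> C" if "A \<in> F" for A
  proof -
    obtain M where M: "M \<in> F" "A \<subseteq> M" "\<forall>B\<in>F. M \<subseteq> B \<longrightarrow> M = B"
      using finite_has_maximal2[OF F(1) \<open>A \<in> F\<close>] by auto
    have "D = M" if D: "D \<subseteq> S" "irreducible_in T D" "M \<subseteq> D" for D
    proof -
      obtain B where "B \<in> F" "D \<subseteq> B"
        using below[OF D(2,1)] by blast
      with M(3) D(3) show ?thesis
        by blast
    qed
    moreover have "M \<subseteq> S"
      unfolding F(3) using M(1) by blast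
    ultimately have "M \<in> irreducible_components T S"
      unfolding irreducible_components_def using F(2)[OF M(1)] by blast
    with M(2) show ?thesis
      by blast
  qed
  show "\<exists>C\<in>irreducible_components T S. D \<subseteq> C" if D: "irreducible_in T D" "D \<subseteq> S"
  proof -
    obtain A where "A \<in> F" "D \<subseteq> A"
      using below[OF D] by blast
    with above[OF this(1)] show ?thesis
      by (meson order_trans)
  qed
  show "\<Union>(irreducible_components T S) = S"
  proof
    show "\<Union>(irreducible_components T S) \<subseteq> S"
      by (auto simp: irreducible_components_def)
    show "S \<subseteq> \<Union>(irreducible_components T S)"
      unfolding F(3) using above[unfolded F(3)] by blast
  qed
qed

section \<open>Components of the closure of a recurrent orbit\<close>

lemma irreducible_components_eqI:
  assumes "C \<in> irreducible_components T S" "C \<subseteq> D" "D \<in> irreducible_components T S"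
  shows "C = D"
  using assms unfolding irreducible_components_def by blast

lemma irreducible_in_image:
  assumes cont: "continuous_map (subtopology T U) T \<mu>"
    and S: "irreducible_in T S" "S \<subseteq> U"
  shows "irreducible_in T (\<mu> ` S)"
  unfolding irreducible_in_def
proof (intro conjI allI impI)
  have top: "S \<noteq> {}" "S \<subseteq> topspace T"
    using S(1) by (auto simp: irreducible_in_def)
  then show "\<mu> ` S \<noteq> {}" "\<mu> ` S \<subseteq> topspace T"
    using continuous_map_image_subset_topspace[OF cont] S(2) by auto
  have pull: "\<exists>A'. closedin T A' \<and> (\<forall>x\<in>S. x \<in> A' \<longleftrightarrow> \<mu> x \<in> A)" if A: "closedin T A" for A
  proof -
    obtain A' where "closedin T A'" "{x \<in> topspace (subtopology T U). \<mu> x \<in> A} = A' \<inter> U"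
      using closedin_continuous_map_preimage[OF cont A] unfolding closedin_subtopology by blast
    moreover have "S \<subseteq> topspace (subtopology T U)"
      using top S(2) by auto
    ultimately show ?thesis
      using S(2) by (intro exI[of _ A']) blast
  qed
  fix A B assume AB: "closedin T A \<and> closedin T B \<and> \<mu> ` S \<subseteq> A \<union> B"
  obtain A' where A': "closedin T A'" "\<And>x. x \<in> S \<Longrightarrow> x \<in> A' \<longleftrightarrow> \<mu> x \<in> A"
    using pull AB by meson
  obtain B' where B': "closedin T B'" "\<And>x. x \<in> S \<Longrightarrow> x \<in> B' \<longleftrightarrow> \<mu> x \<in> B"
    using pull AB by meson
  have "S \<subseteq> A' \<union> B'"
    using AB A'(2) B'(2) by blast
  then have "S \<subseteq> A' \<or> S \<subseteq> B'"
    using S(1) A'(1) B'(1) unfolding irreducible_in_def by blast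
  then show "\<mu> ` S \<subseteq> A \<or> \<mu> ` S \<subseteq> B"
    using A'(2) B'(2) by blast
qed

lemma irreducible_in_closure_of:
  assumes "S \<subseteq> topspace T"
  shows "irreducible_in T (T closure_of S) \<longleftrightarrow> irreducible_in T S"
proof -
  have "T closure_of S \<subseteq> A \<longleftrightarrow> S \<subseteq> A" if "closedin T A" for A
    using that assms by (simp add: closure_of_minimal_eq)
  moreover have "T closure_of S = {} \<longleftrightarrow> S = {}"
    using assms by (auto simp: closure_of_eq_empty)
  ultimately show ?thesis
    unfolding irreducible_in_def using assms closure_of_subset_topspace[of T S]
    by (metis closedin_Un)
qed

text \<open>The number \<open>m\<close> is the least period of \<open>x\<close>: by injectivity, a coincidence of two iterates cancels
  to a return to \<open>x\<close> itself, so the iterates before time \<open>m\<close> are distinct.\<close>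

lemma bijection_cycle:
  fixes f :: "'a \<Rightarrow> 'a"
  assumes "finite K" "inj_on f K" "\<And>j::nat. (f ^^ j) x \<in> K"
    and all: "K \<subseteq> range (\<lambda>j. (f ^^ j) x)"
  obtains m where "m > 0" "bij_betw (\<lambda>j. (f ^^ j) x) {..<m} K"
    "\<And>i j. (f ^^ i) x = (f ^^ j) x \<longleftrightarrow> i mod m = j mod m"
proof -
  define c where "c j = (f ^^ j) x" for j
  have cK: "c j \<in> K" and c_Suc: "c (Suc j) = f (c j)" for j
    using assms(3) by (auto simp: c_def)
  have cancel: "c 0 = c d" if "c i = c (i + d)" for i d
    using that
  proof (induction i)
    case (Suc i)
    then have "f (c i) = f (c (i + d))"
      by (simp add: c_Suc)
    then show ?case
      using Suc.IH cK inj_onD[OF assms(2)] by blast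
  qed simp
  have "\<not> inj_on c UNIV"
    using cK assms(1) by (metis finite_imageD finite_subset image_subsetI infinite_UNIV_nat)
  then obtain i j where "c i = c j" "i < j"
    unfolding inj_on_def by (metis linorder_neqE_nat)
  then have ex: "\<exists>p. 0 < p \<and> c 0 = c p"
    using cancel[of i "j - i"] by (intro exI[of _ "j - i"]) auto
  define m where "m = (LEAST p. 0 < p \<and> c 0 = c p)"
  have m: "0 < m" "c 0 = c m"
    using LeastI_ex[OF ex] by (simp_all add: m_def)
  have least: "\<not> (0 < p \<and> c 0 = c p)" if "p < m" for p
    using not_less_Least that unfolding m_def by blast
  have shift: "c (j + m) = c j" for j
    by (induction j) (use m in \<open>simp_all add: c_Suc\<close>)
  have "c (r + k * m) = c r" for r k
  proof (induction k)
    case (Suc k)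
    then show ?case
      using shift[of "r + k * m"] by (simp add: algebra_simps)
  qed simp
  then have c_mod: "c j = c (j mod m)" for j
    by (metis mod_mult_div_eq mult.commute)
  have less: "\<not> (i < j \<and> j < m \<and> c i = c j)" for i j
    using cancel[of i "j - i"] least[of "j - i"] by auto
  have inj: "inj_on c {..<m}"
    unfolding inj_on_def by (metis less lessThan_iff linorder_neqE_nat)
  have image: "c ` {..<m} = K"
  proof
    show "K \<subseteq> c ` {..<m}"
    proof
      fix y assume "y \<in> K"
      then obtain j where "y = c j"
        using all by (auto simp: c_def)
      then show "y \<in> c ` {..<m}"
        using c_mod[of j] m(1) by (intro image_eqI[of _ _ "j mod m"]) auto
    qed
  qed (use cK in blast)
  have eq_iff: "c i = c j \<longleftrightarrow> i mod m = j mod m" for i j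
  proof
    assume "c i = c j"
    then have "c (i mod m) = c (j mod m)"
      using c_mod by metis
    then show "i mod m = j mod m"
      using inj_onD[OF inj] m(1) by simp
  qed (metis c_mod)
  show thesis
    using that[OF m(1)] inj image eq_iff unfolding bij_betw_def c_def by blast
qed

text \<open>The orbit need only be recurrent in a weak sense: deleting finitely many points from its beginning
  does not change the closure. The map \<open>\<mu>\<close> is continuous just on a set \<open>U\<close> that contains the orbit,
  as for a rational map that is regular along the orbit.\<close>

locale recurrent_orbit =
  fixes T :: "'a topology" and U :: "'a set" and \<mu> :: "'a \<Rightarrow> 'a"
    and b :: "nat \<Rightarrow> 'a" and t\<^sub>0 :: nat and Y :: "'a set"
  assumes noetherian: "noetherian_space T"
    and continuous: "continuous_map (subtopology T U) T \<mu>"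
    and domain: "U \<subseteq> topspace T" "\<And>t. b t \<in> U"
    and orbit_Suc: "b (Suc t) = \<mu> (b t)"
    and recurrent: "\<And>s. s \<ge> t\<^sub>0 \<Longrightarrow> T closure_of (b ` {s..}) = Y"
begin

definition components :: "'a set set" where
  "components = irreducible_components T Y"

text \<open>The closure of the image of \<open>C\<close>, computed from the orbit points in \<open>C\<close> alone. Since these are dense
  in \<open>C\<close>, nothing is lost, and \<open>\<mu>\<close> is only applied where it is known to be defined.\<close>

definition next_component :: "'a set \<Rightarrow> 'a set" where
  "next_component C = T closure_of (\<mu> ` (C \<inter> b ` {t\<^sub>0..}))"

lemma b_in_topspace: "b ` A \<subseteq> topspace T"
  using domain by blast

lemma closed_Y: "closedin T Y"
  using recurrent[of t\<^sub>0] closedin_closure_of by (metis order_refl)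

lemma b_in_Y: "t \<ge> t\<^sub>0 \<Longrightarrow> b t \<in> Y"
  using recurrent[of t\<^sub>0] closure_of_subset[OF b_in_topspace[of "{t\<^sub>0..}"]] by auto

lemma components_props:
  shows finite_components: "finite components"
    and closed_component: "C \<in> components \<Longrightarrow> closedin T C"
    and component_irreducible: "C \<in> components \<Longrightarrow> irreducible_in T C"
    and irreducible_subset_component_of_Y: "\<lbrakk>irreducible_in T D; D \<subseteq> Y\<rbrakk>
      \<Longrightarrow> \<exists>C\<in>components. D \<subseteq> C"
    and Union_components: "\<Union>components = Y"
    and component_eqI: "\<lbrakk>C \<in> components; C \<subseteq> D; irreducible_in T D; D \<subseteq> Y\<rbrakk> \<Longrightarrow> D = C"
  using noetherian_components[OF noetherian closed_Y]
  unfolding components_def irreducible_components_def by blast+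

lemma components_antichain: "\<lbrakk>C \<in> components; C \<subseteq> D; D \<in> components\<rbrakk> \<Longrightarrow> D = C"
  unfolding components_def using irreducible_components_eqI by blast

lemma component_of_cover:
  assumes "s \<ge> t\<^sub>0" and F: "finite F" "\<And>A. A \<in> F \<Longrightarrow> closedin T A" and cover: "b ` {s..} \<subseteq> \<Union>F"
    and C: "C \<in> components"
  shows "\<exists>A\<in>F. C \<subseteq> A"
proof -
  have "closedin T (\<Union>F)"
    using F by (rule closedin_Union)
  then have "Y \<subseteq> \<Union>F"
    using closure_of_minimal[OF cover] recurrent[OF \<open>s \<ge> t\<^sub>0\<close>] by metis
  then have "C \<subseteq> \<Union>F"
    using Union_components C by blast
  with irreducible_in_finite_Union[OF component_irreducible[OF C] F] show ?thesis
    by metis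
qed

text \<open>\<open>Y\<close> is the finite union of the closures of the sets \<open>D \<inter> b ` {s..}\<close>, for all components \<open>D\<close>. By
  irreducibility \<open>C\<close> lies in one of them, hence in \<open>D\<close>, which forces \<open>D = C\<close>.\<close>

lemma closure_orbit_component:
  assumes C: "C \<in> components" and s: "s \<ge> t\<^sub>0"
  shows "T closure_of (C \<inter> b ` {s..}) = C"
proof -
  have below: "T closure_of (D \<inter> b ` {s..}) \<subseteq> D" if "D \<in> components" for D
    by (rule closure_of_minimal) (use closed_component[OF that] in auto)
  let ?F = "(\<lambda>D. T closure_of (D \<inter> b ` {s..})) ` components"
  have above: "D \<inter> b ` {s..} \<subseteq> T closure_of (D \<inter> b ` {s..})" for D
    by (rule closure_of_subset) (use b_in_topspace in blast)
  have cover: "b ` {s..} \<subseteq> \<Union>?F"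
  proof
    fix y assume y: "y \<in> b ` {s..}"
    then have "y \<in> \<Union>components"
      unfolding Union_components using b_in_Y s by auto
    with y above show "y \<in> \<Union>?F"
      by auto
  qed
  have "\<exists>A\<in>?F. C \<subseteq> A"
    by (rule component_of_cover[OF s _ _ cover C]) (use finite_components in auto)
  then obtain D where D: "D \<in> components" "C \<subseteq> T closure_of (D \<inter> b ` {s..})"
    by auto
  then have "D = C"
    using below[OF D(1)] components_antichain[OF C _ D(1)] by blast
  with D below[OF C] show ?thesis
    by blast
qed

lemma next_component_irreducible:
  assumes C: "C \<in> components"
  shows "irreducible_in T (next_component C)"
proof -
  let ?S = "C \<inter> b ` {t\<^sub>0..}"
  have "?S \<subseteq> topspace T" "?S \<subseteq> U"
    using domain by auto
  then have "irreducible_in T ?S"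
    using irreducible_in_closure_of closure_orbit_component[OF C order_refl] component_irreducible[OF C] by metis
  then have "irreducible_in T (\<mu> ` ?S)"
    using irreducible_in_image[OF continuous] \<open>?S \<subseteq> U\<close> by blast
  then show ?thesis
    unfolding next_component_def using irreducible_in_closure_of
    by (metis irreducible_in_def)
qed

lemma next_component_subset: "next_component C \<subseteq> Y"
proof -
  have "\<mu> ` (C \<inter> b ` {t\<^sub>0..}) \<subseteq> Y"
    using b_in_Y by (auto simp flip: orbit_Suc)
  then show ?thesis
    unfolding next_component_def using closure_of_minimal closed_Y by metis
qed

lemma orbit_next_component:
  assumes "t \<ge> t\<^sub>0" "b t \<in> C"
  shows "b (Suc t) \<in> next_component C"
proof -
  have "\<mu> ` (C \<inter> b ` {t\<^sub>0..}) \<subseteq> b ` UNIV"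
    by (auto simp flip: orbit_Suc)
  then have "\<mu> ` (C \<inter> b ` {t\<^sub>0..}) \<subseteq> next_component C"
    unfolding next_component_def using b_in_topspace by (intro closure_of_subset) blast
  with assms show ?thesis
    unfolding orbit_Suc by auto
qed

lemma components_subset_next: "components \<subseteq> next_component ` components"
proof
  fix D assume D: "D \<in> components"
  have cover: "b ` {Suc t\<^sub>0..} \<subseteq> \<Union>(next_component ` components)"
  proof
    fix y assume "y \<in> b ` {Suc t\<^sub>0..}"
    then obtain u where "y = b u" "u \<ge> Suc t\<^sub>0"
      by auto
    then obtain t where t: "y = b (Suc t)" "t \<ge> t\<^sub>0"
      by (cases u) auto
    then obtain C where "C \<in> components" "b t \<in> C"
      using b_in_Y[of t] Union_components by auto
    with t orbit_next_component[of t C] show "y \<in> \<Union>(next_component ` components)"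
      by auto
  qed
  have "\<exists>A\<in>next_component ` components. D \<subseteq> A"
    by (rule component_of_cover[OF _ _ _ cover D]) (use finite_components in \<open>auto simp: next_component_def\<close>)
  then obtain C where C: "C \<in> components" "D \<subseteq> next_component C"
    by auto
  then have "next_component C = D"
    using component_eqI[OF D _ next_component_irreducible next_component_subset] by simp
  with C show "D \<in> next_component ` components"
    by blast
qed

text \<open>So far \<open>next_component C\<close> is only known to lie in some component \<open>f C\<close>. The sets
  \<open>next_component C\<close> cover a tail of the orbit, so every component is one of them; hence \<open>f\<close> maps the
  finite set of components onto itself, is therefore injective, and no \<open>next_component C\<close> can be
  smaller than \<open>f C\<close>.\<close>

lemma bij_next_component: "bij_betw next_component components components"
proof -
  have "\<exists>D\<in>components. next_component C \<subseteq> D" if "C \<in> components" for C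
    using irreducible_subset_component_of_Y[OF next_component_irreducible[OF that] next_component_subset] .
  then obtain f where f: "\<And>C. C \<in> components \<Longrightarrow> f C \<in> components"
      "\<And>C. C \<in> components \<Longrightarrow> next_component C \<subseteq> f C"
    by metis
  have eq: "f C = next_component C" if "C \<in> components" "next_component C \<in> components" for C
    using components_antichain[OF that(2) f(2)[OF that(1)] f(1)[OF that(1)]] .
  have "components \<subseteq> f ` components"
  proof
    fix D assume D: "D \<in> components"
    with components_subset_next obtain C where "C \<in> components" "D = next_component C"
      by blast
    with eq[of C] D show "D \<in> f ` components"
      by auto
  qed
  then have surj: "f ` components = components"
    using f(1) by blast
  then have inj: "inj_on f components"
    using finite_components by (simp add: eq_card_imp_inj_on)
  have "next_component C = f C" if C: "C \<in> components" for C
  proof -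
    obtain C' where C': "C' \<in> components" "f C = next_component C'"
      using components_subset_next f(1)[OF C] by blast
    then have "f C' = f C"
      using eq[of C'] f(1)[OF C] by simp
    then have "C' = C"
      using inj C C'(1) by (simp add: inj_on_eq_iff)
    with C' show ?thesis
      by simp
  qed
  moreover have "bij_betw f components components"
    using surj inj by (simp add: bij_betw_def)
  ultimately show ?thesis
    using bij_betw_cong[of components next_component f components] by metis
qed

lemma next_component_in_components: "C \<in> components \<Longrightarrow> next_component C \<in> components"
  using bij_betwE[OF bij_next_component] by simp

lemma next_component_eq_iff:
  "\<lbrakk>A \<in> components; B \<in> components\<rbrakk> \<Longrightarrow> next_component A = next_component B \<longleftrightarrow> A = B"
  using inj_on_eq_iff[OF bij_betw_imp_inj_on[OF bij_next_component]] .

text \<open>The definition of \<open>next_component\<close> speaks about orbit points; density and continuity extend it to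
  all of \<open>C \<inter> U\<close>.\<close>

lemma mutation_next_component:
  assumes C: "C \<in> components" and x: "x \<in> C" "x \<in> U"
  shows "\<mu> x \<in> next_component C"
proof -
  let ?S = "C \<inter> b ` {t\<^sub>0..}"
  have "?S \<subseteq> U"
    using domain by blast
  then have "subtopology T U closure_of ?S = U \<inter> C"
    using closure_orbit_component[OF C order_refl] by (simp add: closure_of_subtopology_open)
  then show ?thesis
    using continuous_map_image_closure_subset[OF continuous, of ?S] x
    unfolding next_component_def by blast
qed

text \<open>Because the components are permuted, a point of the orbit that lies on two components is followed
  only by such points. Then a whole tail, and so its closure \<open>Y\<close>, would be contained in the union of
  the pairwise intersections, and an irreducible component would lie in two different ones.\<close>

lemma unique_component:
  assumes t: "t \<ge> t\<^sub>0" and CD: "C \<in> components" "D \<in> components" "b t \<in> C" "b t \<in> D"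
  shows "C = D"
proof (rule ccontr)
  assume "C \<noteq> D"
  let ?F = "{A \<inter> B | A B. A \<in> components \<and> B \<in> components \<and> A \<noteq> B}"
  have step: "\<exists>A B. A \<in> components \<and> B \<in> components \<and> A \<noteq> B \<and> b (t + j) \<in> A \<inter> B" for j
  proof (induction j)
    case 0
    then show ?case
      using CD \<open>C \<noteq> D\<close> by auto
  next
    case (Suc j)
    then obtain A B where AB: "A \<in> components" "B \<in> components" "A \<noteq> B" "b (t + j) \<in> A" "b (t + j) \<in> B"
      by blast
    then have "next_component A \<in> components" "next_component B \<in> components" "next_component A \<noteq> next_component B"
      by (simp_all add: next_component_in_components next_component_eq_iff)
    moreover have "b (t + Suc j) \<in> next_component A \<inter> next_component B"
      using AB(4,5) orbit_next_component[of "t + j"] t by simp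
    ultimately show ?case
      by metis
  qed
  have cover: "b ` {t..} \<subseteq> \<Union>?F"
  proof
    fix y assume "y \<in> b ` {t..}"
    then obtain j where "y = b (t + j)"
      by (metis atLeast_iff image_iff le_Suc_ex)
    with step[of j] show "y \<in> \<Union>?F"
      by auto
  qed
  have "?F \<subseteq> (\<lambda>(A, B). A \<inter> B) ` (components \<times> components)"
    by auto
  then have "finite ?F"
    using finite_components by (meson finite_SigmaI finite_imageI finite_subset)
  then have "\<exists>E\<in>?F. C \<subseteq> E"
    by (rule component_of_cover[OF t _ _ cover CD(1)]) (use closed_component in auto)
  then obtain A B where "A \<in> components" "B \<in> components" "A \<noteq> B" "C \<subseteq> A" "C \<subseteq> B"
    by auto
  then show False
    using components_antichain CD(1) by metis
qed

text \<open>Every component is reached from the one that contains \<open>b t\<^sub>0\<close>, because the components reached from it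
  contain the whole tail of the orbit. So \<open>next_component\<close> is a single cycle, along which the
  components are numbered.\<close>

theorem cyclic_numbering:
  obtains m X where "m > 0" "bij_betw X {1..m} components"
    "\<And>t i. t \<ge> t\<^sub>0 \<Longrightarrow> b t \<in> X i \<longleftrightarrow> t mod m = i mod m"
    "\<And>i j. X i = X j \<longleftrightarrow> i mod m = j mod m"
    "\<And>i::nat. X i \<in> components"
    "\<And>i a. \<lbrakk>a \<in> X i; a \<in> U\<rbrakk> \<Longrightarrow> \<mu> a \<in> X (Suc i)"
proof -
  let ?f = next_component
  obtain C\<^sub>0 where C0: "C\<^sub>0 \<in> components" "b t\<^sub>0 \<in> C\<^sub>0"
    using b_in_Y[of t\<^sub>0] Union_components by blast
  define c where "c j = (?f ^^ j) C\<^sub>0" for j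
  have c_component: "c j \<in> components" for j
    by (induction j) (use C0 next_component_in_components in \<open>auto simp: c_def\<close>)
  have b_c: "b (t\<^sub>0 + j) \<in> c j" for j
    by (induction j) (use C0 orbit_next_component in \<open>auto simp: c_def\<close>)
  have "components \<subseteq> range c"
  proof
    fix D assume D: "D \<in> components"
    have cover: "b ` {t\<^sub>0..} \<subseteq> \<Union>(range c)"
    proof
      fix y assume "y \<in> b ` {t\<^sub>0..}"
      then obtain j where "y = b (t\<^sub>0 + j)"
        by (metis atLeast_iff image_iff le_Suc_ex)
      with b_c show "y \<in> \<Union>(range c)"
        by blast
    qed
    have "finite (range c)"
      using c_component finite_components by (meson finite_subset image_subsetI)
    then have "\<exists>A\<in>range c. D \<subseteq> A"
      by (rule component_of_cover[OF order_refl _ _ cover D]) (use closed_component c_component in auto)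
    then obtain j where "D \<subseteq> c j"
      by auto
    then show "D \<in> range c"
      using components_antichain[OF D] c_component by blast
  qed
  then obtain m where m: "m > 0" and bij: "bij_betw c {..<m} components"
    and c_eq: "\<And>i j. c i = c j \<longleftrightarrow> i mod m = j mod m"
    using bijection_cycle[OF finite_components bij_betw_imp_inj_on[OF bij_next_component], of C\<^sub>0] c_component
    unfolding c_def by metis
  \<comment> \<open>\<open>c j\<close> contains the point with index \<open>t\<^sub>0 + j\<close>, so the numbering has to be shifted back by
    \<open>t\<^sub>0\<close>; modulo \<open>m\<close> this is a shift forward by \<open>t\<^sub>0 * (m - 1)\<close>.\<close>
  define X where "X i = c (i + t\<^sub>0 * (m - 1))" for i
  have X_component: "X i \<in> components" for i
    by (simp add: X_def c_component)
  have X_eq: "X i = X j \<longleftrightarrow> i mod m = j mod m" for i j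
    by (simp add: X_def c_eq nat_mod_eq_iff)
  have b_X: "b t \<in> X t" if "t \<ge> t\<^sub>0" for t
  proof -
    have "t + t\<^sub>0 * (m - 1) = (t - t\<^sub>0) + t\<^sub>0 * m"
      using that m by (cases m) auto
    then have "X t = c (t - t\<^sub>0)"
      unfolding X_def c_eq by simp
    with b_c[of "t - t\<^sub>0"] that show ?thesis
      by simp
  qed
  have "inj_on X {1..m}"
  proof (rule inj_onI)
    fix i j assume ij: "i \<in> {1..m}" "j \<in> {1..m}" "X i = X j"
    then have "i mod m = j mod m"
      by (simp add: X_eq)
    with ij show "i = j"
      by (cases "i = m"; cases "j = m") auto
  qed
  moreover have "card components = m"
    using bij_betw_same_card[OF bij] by simp
  ultimately have "X ` {1..m} = components"
    using X_component finite_components by (intro card_subset_eq) (auto simp: card_image)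
  with \<open>inj_on X {1..m}\<close> have "bij_betw X {1..m} components"
    by (simp add: bij_betw_def)
  then show thesis
  proof (rule that[OF m _ _ X_eq X_component])
    show "b t \<in> X i \<longleftrightarrow> t mod m = i mod m" if "t \<ge> t\<^sub>0" for t i
      using unique_component[OF that X_component X_component b_X[OF that], of i] b_X[OF that] X_eq by metis
    show "\<mu> a \<in> X (Suc i)" if "a \<in> X i" "a \<in> U" for a i
      using mutation_next_component[OF X_component that] by (simp add: X_def c_def)
  qed
qed

end

section \<open>Coxeter mutation is regular on the torus\<close>

definition torus :: "nat set \<Rightarrow> (nat \<Rightarrow> complex) set" where
  "torus I = {a \<in> affine_space I. \<forall>i\<in>I. a i \<noteq> 0}"

text \<open>One denominator has to serve on the whole torus, which makes the zero set of such a function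
  relatively closed there.\<close>

definition regular_on_torus :: "nat set \<Rightarrow> ((nat \<Rightarrow> complex) \<Rightarrow> complex) \<Rightarrow> bool" where
  "regular_on_torus I F \<longleftrightarrow>
     (\<exists>p\<in>polynomial_funs I. \<exists>q\<in>polynomial_funs I. \<forall>a\<in>torus I. q a \<noteq> 0 \<and> F a = p a / q a)"

lemma regular_on_torusI:
  assumes "p \<in> polynomial_funs I" "q \<in> polynomial_funs I"
    and "\<And>a. a \<in> torus I \<Longrightarrow> q a \<noteq> 0" "\<And>a. a \<in> torus I \<Longrightarrow> F a = p a / q a"
  shows "regular_on_torus I F"
  using assms unfolding regular_on_torus_def by blast

lemma regular_polynomial: "p \<in> polynomial_funs I \<Longrightarrow> regular_on_torus I p"
  by (rule regular_on_torusI[of p I "\<lambda>_. 1"]) (auto intro: polynomial_funs.const)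

lemma regular_add:
  assumes "regular_on_torus I F" "regular_on_torus I G"
  shows "regular_on_torus I (\<lambda>a. F a + G a)"
proof -
  obtain p q p' q' where F: "p \<in> polynomial_funs I" "q \<in> polynomial_funs I"
      "\<forall>a\<in>torus I. q a \<noteq> 0 \<and> F a = p a / q a"
    and G: "p' \<in> polynomial_funs I" "q' \<in> polynomial_funs I"
      "\<forall>a\<in>torus I. q' a \<noteq> 0 \<and> G a = p' a / q' a"
    using assms unfolding regular_on_torus_def by blast
  show ?thesis
    by (rule regular_on_torusI[of "\<lambda>a. p a * q' a + p' a * q a" I "\<lambda>a. q a * q' a"])
      (use F G in \<open>auto intro!: polynomial_funs.intros simp: add_frac_eq\<close>)
qed

lemma regular_mult:
  assumes "regular_on_torus I F" "regular_on_torus I G"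
  shows "regular_on_torus I (\<lambda>a. F a * G a)"
proof -
  obtain p q p' q' where F: "p \<in> polynomial_funs I" "q \<in> polynomial_funs I"
      "\<forall>a\<in>torus I. q a \<noteq> 0 \<and> F a = p a / q a"
    and G: "p' \<in> polynomial_funs I" "q' \<in> polynomial_funs I"
      "\<forall>a\<in>torus I. q' a \<noteq> 0 \<and> G a = p' a / q' a"
    using assms unfolding regular_on_torus_def by blast
  show ?thesis
    by (rule regular_on_torusI[of "\<lambda>a. p a * p' a" I "\<lambda>a. q a * q' a"])
      (use F G in \<open>auto intro!: polynomial_funs.intros\<close>)
qed

lemma regular_prod:
  assumes "\<And>e. e \<in> E \<Longrightarrow> regular_on_torus I (F e)"
  shows "regular_on_torus I (\<lambda>a. \<Prod>e\<in>E. F e a)"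
  using assms
  by (induction E rule: infinite_finite_induct)
    (auto intro: regular_polynomial polynomial_funs.const regular_mult)

lemma regular_inverse_coord:
  assumes "k \<in> I"
  shows "regular_on_torus I (\<lambda>a. 1 / a k)"
  by (rule regular_on_torusI[of "\<lambda>_. 1" I "\<lambda>a. a k"])
    (use assms in \<open>auto intro: polynomial_funs.intros simp: torus_def\<close>)

context
  fixes Q :: "'e quiver"
  assumes wf: "wf_digraph Q"
begin

text \<open>Mutation divides only by coordinates of the initial point.\<close>

lemma regular_mutation_coord:
  "k \<in> verts Q \<Longrightarrow> regular_on_torus (verts Q) (\<lambda>a. mutation_coord Q a k)"
proof (induction k rule: less_induct)
  case (less k)
  let ?in = "{e \<in> arcs Q. head Q e = k}" and ?out = "{e \<in> arcs Q. tail Q e = k \<and> head Q e < k}"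
  have eq: "mutation_coord Q a k = (1 + (\<Prod>e\<in>?in. a (tail Q e)) *
      (\<Prod>e\<in>?out. mutation_coord Q a (head Q e))) * (1 / a k)" for a
    by (subst mutation_coord.simps) simp
  have "regular_on_torus (verts Q) (\<lambda>a. a (tail Q e))" if "e \<in> ?in" for e
    using that wf by (intro regular_polynomial polynomial_funs.coord) (auto simp: wf_digraph_def)
  moreover have "regular_on_torus (verts Q) (\<lambda>a. mutation_coord Q a (head Q e))" if "e \<in> ?out" for e
    using that wf by (intro less.IH) (auto simp: wf_digraph_def)
  ultimately show ?case
    unfolding eq
    by (intro regular_mult regular_add regular_prod regular_inverse_coord less.prems)
      (auto intro: regular_polynomial polynomial_funs.const)
qed

lemma regular_polynomial_mutation:
  "g \<in> polynomial_funs (verts Q) \<Longrightarrow> regular_on_torus (verts Q) (\<lambda>a. g (coxeter_mutation Q a))"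
proof (induction rule: polynomial_funs.induct)
  case (coord i)
  then show ?case
    using regular_mutation_coord by (simp add: coxeter_mutation_def)
qed (auto intro: regular_polynomial polynomial_funs.const regular_add regular_mult)

lemma continuous_coxeter_mutation:
  "continuous_map (subtopology (zariski (verts Q)) (torus (verts Q))) (zariski (verts Q))
     (coxeter_mutation Q)"
  unfolding continuous_map_closedin
proof (intro conjI allI impI)
  show "coxeter_mutation Q \<in> topspace (subtopology (zariski (verts Q)) (torus (verts Q)))
      \<rightarrow> topspace (zariski (verts Q))"
    by (auto simp: coxeter_mutation_def affine_space_def)
next
  let ?I = "verts Q"
  fix Z assume "closedin (zariski ?I) Z"
  then obtain F where F: "F \<subseteq> polynomial_funs ?I" "Z = zero_locus ?I F"
    unfolding closedin_zariski by blast
  have "\<exists>p. p \<in> polynomial_funs ?I \<and> (\<forall>a\<in>torus ?I. p a = 0 \<longleftrightarrow> g (coxeter_mutation Q a) = 0)"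
    if "g \<in> F" for g
    using regular_polynomial_mutation[of g] that F(1) unfolding regular_on_torus_def
    by (metis divide_eq_0_iff subsetD)
  then obtain p where p: "\<And>g. g \<in> F \<Longrightarrow> p g \<in> polynomial_funs ?I"
      "\<And>g a. \<lbrakk>g \<in> F; a \<in> torus ?I\<rbrakk> \<Longrightarrow> p g a = 0 \<longleftrightarrow> g (coxeter_mutation Q a) = 0"
    by metis
  have "coxeter_mutation Q a \<in> affine_space ?I" for a
    by (simp add: coxeter_mutation_def affine_space_def)
  then have "{a \<in> topspace (subtopology (zariski ?I) (torus ?I)). coxeter_mutation Q a \<in> Z} =
      zero_locus ?I (p ` F) \<inter> torus ?I"
    using p(2) unfolding F(2) zero_locus_def by auto
  moreover have "closedin (zariski ?I) (zero_locus ?I (p ` F))"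
    unfolding closedin_zariski using p(1) by blast
  ultimately show "closedin (subtopology (zariski ?I) (torus ?I))
      {a \<in> topspace (subtopology (zariski ?I) (torus ?I)). coxeter_mutation Q a \<in> Z}"
    unfolding closedin_subtopology by blast
qed

end

section \<open>Positive-dimensional components and tails of the orbit\<close>

lemma closedin_zariski_singleton:
  assumes "x \<in> affine_space I"
  shows "closedin (zariski I) {x}"
proof -
  let ?F = "(\<lambda>i y. y i + - x i) ` I"
  have "{x} = zero_locus I ?F"
    using assms by (auto simp: zero_locus_def affine_space_def intro: PiE_ext)
  moreover have "?F \<subseteq> polynomial_funs I"
    by (intro image_subsetI polynomial_funs.intros)
  ultimately show ?thesis
    unfolding closedin_zariski by blast
qed

lemma krull_dim_singleton: "krull_dim T {x} = 0"
proof -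
  have "l = 0" if Z: "\<forall>i\<le>l. closedin (subtopology T {x}) (Z i) \<and> irreducible_in T (Z i)"
      "\<forall>i<l. Z i \<subset> Z (Suc i)" for l and Z :: "nat \<Rightarrow> 'a set"
  proof (rule ccontr)
    assume "l \<noteq> 0"
    then have "Z 0 \<subset> Z 1" "closedin (subtopology T {x}) (Z 1)" "Z 0 \<noteq> {}"
      using Z by (auto simp: irreducible_in_def)
    moreover from this(2) have "Z 1 = {} \<or> Z 1 = {x}"
      using closedin_subset by fastforce
    ultimately show False
      by auto
  qed
  then have "krull_dim T {x} \<le> 0"
    unfolding krull_dim_def by (intro Sup_least) (auto simp: zero_enat_def)
  then show ?thesis
    by simp
qed

text \<open>Points are closed, so deleting finitely many points of the orbit removes at most these points from
  its closure.
  A component of positive dimension is irreducible and not a point, so it survives inside the closure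
  of the tail; conversely the tail lies in the union of these components by assumption.\<close>

lemma closure_tail_eq_positive_dim_components:
  fixes b :: "nat \<Rightarrow> 'a"
  assumes noeth: "noetherian_space T" and t1: "\<And>t. closedin T {b t}"
    and R: "R = \<Union>{C \<in> irreducible_components T (T closure_of range b). krull_dim T C \<noteq> 0}"
    and tail: "\<And>t. t \<ge> s \<Longrightarrow> b t \<in> R"
  shows "T closure_of (b ` {s..}) = R"
proof
  note comps = noetherian_components[OF noeth closedin_closure_of[of T "range b"]]
  have "finite {C \<in> irreducible_components T (T closure_of range b). krull_dim T C \<noteq> 0}"
    using comps(1) by simp
  then have "closedin T R"
    unfolding R by (rule closedin_Union) (use comps(2) in blast)
  then show "T closure_of (b ` {s..}) \<subseteq> R"
    by (intro closure_of_minimal) (use tail in auto)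
next
  have "C \<subseteq> T closure_of (b ` {s..})"
    if C: "C \<in> irreducible_components T (T closure_of range b)" and dim: "krull_dim T C \<noteq> 0" for C
  proof -
    let ?F = "insert (T closure_of (b ` {s..})) ((\<lambda>t. {b t}) ` {..<s})"
    have irr: "irreducible_in T C" and C_sub: "C \<subseteq> T closure_of range b"
      using C by (auto simp: irreducible_components_def)
    have closed: "closedin T A" if "A \<in> ?F" for A
      using that t1 by auto
    have top: "b ` {s..} \<subseteq> topspace T"
      using t1 closedin_subset by blast
    have "range b \<subseteq> \<Union>?F"
    proof
      fix y assume "y \<in> range b"
      then obtain t where "y = b t"
        by blast
      then show "y \<in> \<Union>?F"
        using closure_of_subset[OF top] by (cases "t < s") auto
    qed
    then have "T closure_of range b \<subseteq> \<Union>?F"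
      by (rule closure_of_minimal) (rule closedin_Union, use closed in auto)
    with C_sub have cover: "C \<subseteq> \<Union>?F"
      by (rule subset_trans)
    have "finite ?F"
      by simp
    then obtain A where A: "A \<in> ?F" "C \<subseteq> A"
      by (rule irreducible_in_finite_Union[OF irr _ closed cover])
    have "C \<noteq> {x}" for x
      using dim krull_dim_singleton by metis
    moreover have "C \<noteq> {}"
      using irr by (simp add: irreducible_in_def)
    ultimately show ?thesis
      using A by (auto simp: subset_singleton_iff)
  qed
  then show "R \<subseteq> T closure_of (b ` {s..})"
    unfolding R by blast
qed

section \<open>The structure of generalized frieze varieties\<close>

theorem theorem3p2:
  fixes Q :: "(nat, 'e) pre_digraph" and n t\<^sub>0 :: nat and b :: "nat \<Rightarrow> complex"
  assumes "fin_digraph Q"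
    and "verts Q = {1..n}"
    and "Digraph_Component.connected Q"
    and "\<nexists>p. pre_digraph.cycle Q p"
    and "\<And>e. e \<in> arcs Q \<Longrightarrow> tail Q e > head Q e"
    and "generic_specialization Q b"
    and "\<And>t. t \<ge> t\<^sub>0 \<Longrightarrow> (coxeter_mutation Q ^^ t) b \<in> reduced_frieze_variety Q b"
  shows "reduced_frieze_variety Q b = frieze_variety Q ((coxeter_mutation Q ^^ t\<^sub>0) b) \<and>
    (\<exists>(m::nat) X.
       bij_betw X {1..m}
         (irreducible_components (zariski (verts Q)) (reduced_frieze_variety Q b)) \<and>
       (\<forall>t\<ge>t\<^sub>0.
          (\<forall>i\<in>{1..m}. (coxeter_mutation Q ^^ t) b \<in> X i \<longleftrightarrow> t mod m = i mod m) \<and>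
          (\<exists>!i. i \<in> {1..m} \<and> (coxeter_mutation Q ^^ t) b \<in> X i)) \<and>
       (\<forall>i\<in>{1..m}. X i = zariski (verts Q) closure_of
          {(coxeter_mutation Q ^^ (i + k * m)) b | k::nat. real k \<ge> real t\<^sub>0 / real m}) \<and>
       (\<forall>i\<in>{1..m}. \<forall>a \<in> X i. (\<forall>j\<in>verts Q. a j \<noteq> 0) \<longrightarrow>
          coxeter_mutation Q a \<in> X (if i = m then 1 else i + 1)))"
proof -
  let ?T = "zariski (verts Q)" and ?\<mu> = "coxeter_mutation Q" and ?R = "reduced_frieze_variety Q b"
  define x where "x t = (?\<mu> ^^ t) b" for t
  have wf: "wf_digraph Q"
    using assms(1) by (simp add: fin_digraph_def)
  have noeth: "noetherian_space ?T"
    using assms(2) by (intro noetherian_zariski) simp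
  have x_affine: "x t \<in> affine_space (verts Q)" for t
    using assms(6)
    by (cases t) (auto simp: x_def generic_specialization_def coxeter_mutation_def affine_space_def)
  then have x_torus: "x t \<in> torus (verts Q)" for t
    using assms(6) by (simp add: x_def generic_specialization_def torus_def)
  have "mutation_orbit Q b = range x"
    by (auto simp: mutation_orbit_def x_def)
  then have R: "?R = \<Union>{C \<in> irreducible_components ?T (?T closure_of range x). krull_dim ?T C \<noteq> 0}"
    by (simp add: reduced_frieze_variety_def frieze_variety_def)
  have tail: "?T closure_of (x ` {s..}) = ?R" if "s \<ge> t\<^sub>0" for s
    using that assms(7)
    by (intro closure_tail_eq_positive_dim_components noeth closedin_zariski_singleton x_affine R)
      (simp add: x_def)
  interpret recurrent_orbit ?T "torus (verts Q)" ?\<mu> x t\<^sub>0 ?R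
  proof
    show "torus (verts Q) \<subseteq> topspace ?T"
      by (auto simp: torus_def)
    show "x (Suc t) = ?\<mu> (x t)" for t
      by (simp add: x_def)
  qed (use noeth continuous_coxeter_mutation[OF wf] x_torus tail in auto)
  obtain m X where m: "m > 0" and bij: "bij_betw X {1..m} components"
    and x_X: "\<And>t i. t \<ge> t\<^sub>0 \<Longrightarrow> x t \<in> X i \<longleftrightarrow> t mod m = i mod m"
    and X_eq: "\<And>i j. X i = X j \<longleftrightarrow> i mod m = j mod m"
    and X_component: "\<And>i::nat. X i \<in> components"
    and X_Suc: "\<And>i a. \<lbrakk>a \<in> X i; a \<in> torus (verts Q)\<rbrakk> \<Longrightarrow> ?\<mu> a \<in> X (Suc i)"
    using cyclic_numbering by blast
  have shift: "(?\<mu> ^^ t) (x t\<^sub>0) = x (t + t\<^sub>0)" for t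
    by (simp add: x_def funpow_add)
  have "mutation_orbit Q (x t\<^sub>0) = x ` {t\<^sub>0..}"
  proof
    show "mutation_orbit Q (x t\<^sub>0) \<subseteq> x ` {t\<^sub>0..}"
      unfolding mutation_orbit_def shift by auto
    show "x ` {t\<^sub>0..} \<subseteq> mutation_orbit Q (x t\<^sub>0)"
    proof
      fix y assume "y \<in> x ` {t\<^sub>0..}"
      then obtain t where "y = x t" "t \<ge> t\<^sub>0"
        by auto
      then have "y = x ((t - t\<^sub>0) + t\<^sub>0)"
        by simp
      then show "y \<in> mutation_orbit Q (x t\<^sub>0)"
        unfolding mutation_orbit_def shift by blast
    qed
  qed
  then have variety: "?R = frieze_variety Q (x t\<^sub>0)"
    using tail[of t\<^sub>0] by (simp add: frieze_variety_def)
  have unique: "\<exists>!i. i \<in> {1..m} \<and> x t \<in> X i" if t: "t \<ge> t\<^sub>0" for t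
  proof -
    have "x t \<in> \<Union>(X ` {1..m})"
      unfolding bij_betw_imp_surj_on[OF bij] Union_components by (rule b_in_Y[OF t])
    then obtain i where i: "i \<in> {1..m}" "x t \<in> X i"
      by blast
    moreover have "j = i" if "j \<in> {1..m}" "x t \<in> X j" for j
    proof -
      have "X j = X i"
        using unique_component[OF t X_component X_component that(2) i(2)] .
      then show ?thesis
        using inj_onD[OF bij_betw_imp_inj_on[OF bij]] that(1) i(1) by blast
    qed
    ultimately show ?thesis
      by blast
  qed
  have closure: "X i = ?T closure_of {x (i + k * m) | k::nat. real k \<ge> real t\<^sub>0 / real m}" for i
  proof -
    have le: "real k \<ge> real t\<^sub>0 / real m \<longleftrightarrow> t\<^sub>0 \<le> k * m" for k
      using m by (simp add: pos_divide_le_eq flip: of_nat_mult)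
    \<comment> \<open>the points numbered by \<open>k \<ge> t\<^sub>0 / m\<close> start at \<open>t\<^sub>0 + i\<close> instead of \<open>t\<^sub>0\<close>, and a tail of the
      points of \<open>X i\<close> is still dense in \<open>X i\<close>\<close>
    have "{x (i + k * m) | k::nat. t\<^sub>0 \<le> k * m} = X i \<inter> x ` {t\<^sub>0 + i..}"
    proof (intro equalityI subsetI)
      fix y assume "y \<in> {x (i + k * m) | k::nat. t\<^sub>0 \<le> k * m}"
      then obtain k where k: "y = x (i + k * m)" "t\<^sub>0 \<le> k * m"
        by blast
      then show "y \<in> X i \<inter> x ` {t\<^sub>0 + i..}"
        using x_X[of "i + k * m" i] by auto
    next
      fix y assume "y \<in> X i \<inter> x ` {t\<^sub>0 + i..}"
      then obtain t where t: "y = x t" "t \<ge> t\<^sub>0 + i" "x t \<in> X i"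
        by auto
      then have "t mod m = i mod m"
        using x_X[of t i] by simp
      then have "m dvd t - i"
        using t(2) by (simp add: mod_eq_dvd_iff_nat)
      then obtain k where "t - i = k * m"
        by (metis dvdE mult.commute)
      then have "t = i + k * m" "t\<^sub>0 \<le> k * m"
        using t(2) by auto
      with t(1) show "y \<in> {x (i + k * m) | k::nat. t\<^sub>0 \<le> k * m}"
        by blast
    qed
    then show ?thesis
      unfolding le using closure_orbit_component[OF X_component, of "t\<^sub>0 + i" i] by simp
  qed
  have step: "?\<mu> a \<in> X (if i = m then 1 else i + 1)"
    if "i \<in> {1..m}" and a: "a \<in> X i" "\<forall>j\<in>verts Q. a j \<noteq> 0" for i a
  proof -
    have "a \<in> ?R"
      using a(1) X_component Union_components by blast
    then have "a \<in> torus (verts Q)"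
      using a(2) closedin_subset[OF closed_Y] by (auto simp: torus_def)
    moreover have "X (Suc i) = X (if i = m then 1 else i + 1)"
      unfolding X_eq using m by (auto simp: mod_Suc)
    ultimately show ?thesis
      using X_Suc[OF a(1)] by simp
  qed
  show ?thesis
    using variety bij x_X unique closure step unfolding components_def x_def
    by (intro conjI exI[of _ m] exI[of _ X]) simp_all
qed

end
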